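(* Fix $\rho>1$, $\gamma\ge0$ and $\alpha>1$. Let $y$ be a feasible solution of the configuration LP, and fix a machine $i\in M$ and a Smith prefix $[j^*]$ on machine $i$ with positive fractional processing volume $V=\sum_{j\in[j^*]}z_{ij}p_j$; let $Q$, $F$ and $\overline S$ be the associated normalized quantities (with $\overline S$ defined using class ratio $\rho$). Let $\psi$ be a scale profile (for the ratio $\rho$) with profile cost $\Pi$ and unit-window function $\mathcal W$. Suppose that there exists $t\in\mathbb R$ such that \[ \mathcal W(r)+\alpha h_\gamma(r)-(2-\alpha)r\ \ge\ t\qquad\text{for all } r>0, \] and \[ t+\alpha(2\gamma-\gamma^2)-1-\Pi\ \ge\ 0 . \] Then \[ 2Q+1-\overline S\ \le\ \alpha\,(Q+F). \]
   Context: Setting. $J$ is a finite set of $n$ jobs, $M$ a finite set of machines. Each job $j$ has a machine-independent size $p_j>0$, and each feasible pair $(i,j)$ has a weight $w_{ij}>0$ (infeasible pairs are regarded as having $w_{ij}=+\infty$). For $i\in M$ let $J_i=\{j\in J:(i,j)\text{ feasible}\}$ and let $\mathcal F_i$ be the set of all subsets of $J_i$ (configurations). A feasible solution of the configuration LP is a vector $(y_{if})_{i\in M,f\in\mathcal F_i}$ with $y_{if}\ge 0$, $\sum_{f\in\mathcal F_i}y_{if}=1$ for every $i\in M$, and $\sum_{i\in M}\sum_{f\in\mathcal F_i,\,f\ni j}y_{if}=1$ for every $j\in J$. Set $z_{ij}:=\sum_{f\in\mathcal F_i,\,f\ni j}y_{if}$ if $j\in J_i$ and $z_{ij}:=0$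 otherwise. For a machine $i$, fix a total order of the jobs refining nonincreasing Smith ratio $w_{ij}/p_j$, and index the jobs $1,\dots,n$ in this order; a Smith prefix is a set $[j^*]=\{1,\dots,j^*\}$ with $1\le j^*\le n$. Fixed-prefix normalization. For fixed $i$ and $[j^*]$ let $V:=\sum_{j\in[j^*]}z_{ij}p_j>0$. For $j\in[j^*]$ put $r_j:=p_j/V$. Define \[ Q:=\sum_{j\in[j^*]}z_{ij}r_j^2,\qquad T_f:=\sum_{j\in f\cap[j^*]}r_j\ (f\in\mathcal F_i),\qquad F:=\sum_{f\in\mathcal F_i}y_{if}T_f^2 . \] Class saving. For $\rho>1$, let $\beta\in[1,\rho)$ be random with $\ln\beta$ uniform on $[0,\ln\rho)$. For $k\in\mathbb Z$ let $\tau_k:=\beta\rho^k/V$ and \[ v_k:=\sum_{j\in[j^*]:\ \beta\rho^k\le p_j<\beta\rho^{k+1}} z_{ij}r_j . \] Define $S_\beta:=\sum_{k\in\mathbb Z}\min\{v_k,\tau_k\}^2$ and $\overline S:=\mathbb E_\beta[S_\beta]$. Scale profiles. Let $b(\tau):=1-\sqrt{1-\tau^2}$ for $0<\tau<1$ and $b(\tau):=1$ for $\tau\ge1$. A scale profile (for $\rho$) is a measurable function $\psi:\mathbb R\to\mathbb R_{\ge0}$ with $0\le\psi(s)\le b(\rho^s)$ for all $s\in\mathbb R$ and profile cost $\Pi:=\int_{-\infty}^{\infty}\psi(s)^2\,ds<\infty$. Its unit-window function is \[ \mathcal W(r):=2\int_{\log_\rho r-1}^{\log_\rho r}\psi(s)\,ds,\qquad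 r>0. \] For $\gamma\ge0$, $h_\gamma(r):=(r-\gamma)_+^2/r$ for $r>0$, where $x_+:=\max\{x,0\}$. *)

theory Defs
  imports "HOL-Probability.Probability"
begin

text \<open>Weights are extended reals: the pair \<open>(i, j)\<close> is feasible iff \<open>w i j < \<infinity>\<close>.\<close>

definition scheduling_instance ::
    "'j set \<Rightarrow> 'm set \<Rightarrow> ('j \<Rightarrow> real) \<Rightarrow> ('m \<Rightarrow> 'j \<Rightarrow> ereal) \<Rightarrow> bool" where
  "scheduling_instance J M p w \<longleftrightarrow>
     finite J \<and> finite M \<and> (\<forall>j\<in>J. 0 < p j) \<and> (\<forall>i\<in>M. \<forall>j\<in>J. 0 < w i j)"

definition feasible_jobs :: "'j set \<Rightarrow> ('m \<Rightarrow> 'j \<Rightarrow> ereal) \<Rightarrow> 'm \<Rightarrow> 'j set" where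
  "feasible_jobs J w i = {j \<in> J. w i j < \<infinity>}"

definition configs :: "'j set \<Rightarrow> ('m \<Rightarrow> 'j \<Rightarrow> ereal) \<Rightarrow> 'm \<Rightarrow> 'j set set" where
  "configs J w i = Pow (feasible_jobs J w i)"

definition config_lp_feasible ::
    "'j set \<Rightarrow> 'm set \<Rightarrow> ('m \<Rightarrow> 'j \<Rightarrow> ereal) \<Rightarrow> ('m \<Rightarrow> 'j set \<Rightarrow> real) \<Rightarrow> bool" where
  "config_lp_feasible J M w y \<longleftrightarrow>
     (\<forall>i\<in>M. \<forall>f\<in>configs J w i. 0 \<le> y i f) \<and>
     (\<forall>i\<in>M. (\<Sum>f\<in>configs J w i. y i f) = 1) \<and>
     (\<forall>j\<in>J. (\<Sum>i\<in>M. \<Sum>f\<in>{f \<in> configs J w i. j \<in> f}. y i f) = 1)"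

definition zfrac ::
    "'j set \<Rightarrow> ('m \<Rightarrow> 'j \<Rightarrow> ereal) \<Rightarrow> ('m \<Rightarrow> 'j set \<Rightarrow> real) \<Rightarrow> 'm \<Rightarrow> 'j \<Rightarrow> real" where
  "zfrac J w y i j =
     (if j \<in> feasible_jobs J w i then \<Sum>f\<in>{f \<in> configs J w i. j \<in> f}. y i f else 0)"

text \<open>
  A total order of the jobs on machine \<open>i\<close> is an enumeration \<open>\<sigma>\<close> of \<open>J\<close> by \<open>{1..card J}\<close>. Ratios are
  taken in the extended reals, so infeasible jobs have ratio \<open>\<infinity>\<close> and come first (they have \<open>z = 0\<close>).
\<close>

definition smith_ratio :: "('j \<Rightarrow> real) \<Rightarrow> ('m \<Rightarrow> 'j \<Rightarrow> ereal) \<Rightarrow> 'm \<Rightarrow> 'j \<Rightarrow> ereal" where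
  "smith_ratio p w i j = w i j / ereal (p j)"

definition smith_order ::
    "'j set \<Rightarrow> ('j \<Rightarrow> real) \<Rightarrow> ('m \<Rightarrow> 'j \<Rightarrow> ereal) \<Rightarrow> 'm \<Rightarrow> (nat \<Rightarrow> 'j) \<Rightarrow> bool" where
  "smith_order J p w i \<sigma> \<longleftrightarrow>
     bij_betw \<sigma> {1..card J} J \<and>
     (\<forall>a\<in>{1..card J}. \<forall>b\<in>{1..card J}.
        a \<le> b \<longrightarrow> smith_ratio p w i (\<sigma> b) \<le> smith_ratio p w i (\<sigma> a))"

definition smith_prefix :: "(nat \<Rightarrow> 'j) \<Rightarrow> nat \<Rightarrow> 'j set" where
  "smith_prefix \<sigma> js = \<sigma> ` {1..js}"

text \<open>In the following, \<open>P\<close> stands for the prefix.\<close>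

definition Vol ::
    "'j set \<Rightarrow> ('j \<Rightarrow> real) \<Rightarrow> ('m \<Rightarrow> 'j \<Rightarrow> ereal) \<Rightarrow> ('m \<Rightarrow> 'j set \<Rightarrow> real) \<Rightarrow> 'm \<Rightarrow> 'j set \<Rightarrow> real" where
  "Vol J p w y i P = (\<Sum>j\<in>P. zfrac J w y i j * p j)"

definition rsize ::
    "'j set \<Rightarrow> ('j \<Rightarrow> real) \<Rightarrow> ('m \<Rightarrow> 'j \<Rightarrow> ereal) \<Rightarrow> ('m \<Rightarrow> 'j set \<Rightarrow> real) \<Rightarrow> 'm \<Rightarrow> 'j set \<Rightarrow> 'j \<Rightarrow> real" where
  "rsize J p w y i P j = p j / Vol J p w y i P"

definition Qnorm ::
    "'j set \<Rightarrow> ('j \<Rightarrow> real) \<Rightarrow> ('m \<Rightarrow> 'j \<Rightarrow> ereal) \<Rightarrow> ('m \<Rightarrow> 'j set \<Rightarrow> real) \<Rightarrow> 'm \<Rightarrow> 'j set \<Rightarrow> real" where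
  "Qnorm J p w y i P = (\<Sum>j\<in>P. zfrac J w y i j * (rsize J p w y i P j)\<^sup>2)"

definition Tload ::
    "'j set \<Rightarrow> ('j \<Rightarrow> real) \<Rightarrow> ('m \<Rightarrow> 'j \<Rightarrow> ereal) \<Rightarrow> ('m \<Rightarrow> 'j set \<Rightarrow> real) \<Rightarrow> 'm \<Rightarrow> 'j set \<Rightarrow> 'j set \<Rightarrow> real" where
  "Tload J p w y i P f = (\<Sum>j\<in>f \<inter> P. rsize J p w y i P j)"

definition Fnorm ::
    "'j set \<Rightarrow> ('j \<Rightarrow> real) \<Rightarrow> ('m \<Rightarrow> 'j \<Rightarrow> ereal) \<Rightarrow> ('m \<Rightarrow> 'j set \<Rightarrow> real) \<Rightarrow> 'm \<Rightarrow> 'j set \<Rightarrow> real" where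
  "Fnorm J p w y i P = (\<Sum>f\<in>configs J w i. y i f * (Tload J p w y i P f)\<^sup>2)"

definition tau_class ::
    "'j set \<Rightarrow> ('j \<Rightarrow> real) \<Rightarrow> ('m \<Rightarrow> 'j \<Rightarrow> ereal) \<Rightarrow> ('m \<Rightarrow> 'j set \<Rightarrow> real) \<Rightarrow> 'm \<Rightarrow> 'j set \<Rightarrow>
     real \<Rightarrow> real \<Rightarrow> int \<Rightarrow> real" where
  "tau_class J p w y i P \<rho> \<beta> k = \<beta> * \<rho> powi k / Vol J p w y i P"

definition v_class ::
    "'j set \<Rightarrow> ('j \<Rightarrow> real) \<Rightarrow> ('m \<Rightarrow> 'j \<Rightarrow> ereal) \<Rightarrow> ('m \<Rightarrow> 'j set \<Rightarrow> real) \<Rightarrow> 'm \<Rightarrow> 'j set \<Rightarrow>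
     real \<Rightarrow> real \<Rightarrow> int \<Rightarrow> real" where
  "v_class J p w y i P \<rho> \<beta> k =
     (\<Sum>j\<in>{j \<in> P. \<beta> * \<rho> powi k \<le> p j \<and> p j < \<beta> * \<rho> powi (k + 1)}.
        zfrac J w y i j * rsize J p w y i P j)"

text \<open>Only finitely many terms of the following sum are nonzero, since \<open>P\<close> is finite.\<close>

definition class_saving ::
    "'j set \<Rightarrow> ('j \<Rightarrow> real) \<Rightarrow> ('m \<Rightarrow> 'j \<Rightarrow> ereal) \<Rightarrow> ('m \<Rightarrow> 'j set \<Rightarrow> real) \<Rightarrow> 'm \<Rightarrow> 'j set \<Rightarrow>
     real \<Rightarrow> real \<Rightarrow> real" where
  "class_saving J p w y i P \<rho> \<beta> =
     (\<Sum>\<^sub>\<infinity>k\<in>UNIV. (min (v_class J p w y i P \<rho> \<beta> k) (tau_class J p w y i P \<rho> \<beta> k))\<^sup>2)"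

text \<open>The law of \<open>\<beta>\<close> with \<open>ln \<beta>\<close> uniform on \<open>[0, ln \<rho>)\<close>.\<close>

definition beta_law :: "real \<Rightarrow> real measure" where
  "beta_law \<rho> = distr (uniform_measure lborel {0..<ln \<rho>}) borel exp"

definition mean_class_saving ::
    "'j set \<Rightarrow> ('j \<Rightarrow> real) \<Rightarrow> ('m \<Rightarrow> 'j \<Rightarrow> ereal) \<Rightarrow> ('m \<Rightarrow> 'j set \<Rightarrow> real) \<Rightarrow> 'm \<Rightarrow> 'j set \<Rightarrow>
     real \<Rightarrow> real" where
  "mean_class_saving J p w y i P \<rho> =
     prob_space.expectation (beta_law \<rho>) (class_saving J p w y i P \<rho>)"

definition bcap :: "real \<Rightarrow> real" where
  "bcap \<tau> = (if \<tau> < 1 then 1 - sqrt (1 - \<tau>\<^sup>2) else 1)"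

text \<open>Since \<open>\<psi>\<^sup>2\<close> is nonnegative and measurable, a finite cost means that \<open>\<psi>\<^sup>2\<close> is integrable.\<close>

definition profile_cost :: "(real \<Rightarrow> real) \<Rightarrow> real" where
  "profile_cost \<psi> = (LINT s|lebesgue. (\<psi> s)\<^sup>2)"

definition scale_profile :: "real \<Rightarrow> (real \<Rightarrow> real) \<Rightarrow> bool" where
  "scale_profile \<rho> \<psi> \<longleftrightarrow>
     \<psi> \<in> borel_measurable lebesgue \<and>
     (\<forall>s. 0 \<le> \<psi> s \<and> \<psi> s \<le> bcap (\<rho> powr s)) \<and>
     integrable lebesgue (\<lambda>s. (\<psi> s)\<^sup>2)"

definition unit_window :: "real \<Rightarrow> (real \<Rightarrow> real) \<Rightarrow> real \<Rightarrow> real" where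
  "unit_window \<rho> \<psi> r = 2 * (LINT s:{log \<rho> r - 1..log \<rho> r}|lebesgue. \<psi> s)"

definition hexcess :: "real \<Rightarrow> real \<Rightarrow> real" where
  "hexcess \<gamma> r = (max (r - \<gamma>) 0)\<^sup>2 / r"

end

theory Submission
  imports Defs
begin

text \<open>
  With \<open>\<tau> = \<rho>\<^sup>s\<close> and \<open>v(s)\<close> the mass of the jobs with \<open>\<tau> \<le> r\<^sub>j < \<rho> \<tau>\<close>, averaging over \<open>\<beta>\<close>
  turns the mean class saving into the integral of \<open>(min v(s) \<tau>)\<^sup>2\<close> over all \<open>s\<close>. Because \<open>v \<le> 1\<close>,
  the cap on \<open>\<psi>\<close> is exactly what makes \<open>(min v \<tau>)\<^sup>2 \<ge> 2 \<psi> v - \<psi>\<^sup>2\<close>; integrating, the saving is at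
  least the \<open>z\<^sub>j r\<^sub>j\<close>-average of the window function minus the profile cost. The load term \<open>F\<close>
  is bounded below by \<open>T\<^sup>2 \<ge> 2 \<gamma> T - \<gamma>\<^sup>2 + (T - \<gamma>)\<^sub>+\<^sup>2\<close> and the superadditivity of the last term.
  The weights \<open>z\<^sub>j r\<^sub>j\<close> sum to 1, so averaging the pointwise hypothesis over \<open>r = r\<^sub>j\<close> combines
  the two bounds.
\<close>

section \<open>Pointwise inequalities for a truncated mass and for an excess load\<close>

text \<open>For \<open>v \<le> \<tau>\<close> this is \<open>(v - b)^2 \<ge> 0\<close>. Otherwise
  \<open>\<tau> < 1\<close>, and \<open>bcap \<tau>\<close> is the smaller root of
  \<open>2 b - b^2 = \<tau>^2\<close>, so staying below it settles the extreme case
  \<open>v = 1\<close>; a smaller \<open>v\<close> only decreases the left side.\<close>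

lemma two_mult_diff_square_le_min_square:
  fixes v \<tau> b :: real
  assumes "0 \<le> v" "v \<le> 1" "0 < \<tau>" "0 \<le> b" "b \<le> bcap \<tau>"
  shows "2 * b * v - b\<^sup>2 \<le> (min v \<tau>)\<^sup>2"
proof (cases "v \<le> \<tau>")
  case True
  have "0 \<le> (v - b)\<^sup>2" by simp
  then show ?thesis using True by (simp add: power2_diff min_def algebra_simps)
next
  case False
  with assms have \<tau>: "\<tau> < 1" by simp
  have sq: "\<tau>\<^sup>2 \<le> 1" using \<tau> assms by (simp add: power_le_one)
  have "sqrt (1 - \<tau>\<^sup>2) \<le> 1 - b" using assms \<tau> by (simp add: bcap_def)
  then have "(sqrt (1 - \<tau>\<^sup>2))\<^sup>2 \<le> (1 - b)\<^sup>2"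
    using sq by (intro power_mono) auto
  then have "2 * b - b\<^sup>2 \<le> \<tau>\<^sup>2" using sq by (simp add: power2_diff)
  moreover have "b * v \<le> b" using assms by (simp add: mult_left_le)
  ultimately show ?thesis using False by (simp add: min_def)
qed

text \<open>Adding two nonnegative loads before subtracting \<open>\<gamma>\<close> pays the
  threshold once instead of twice, so the positive parts are superadditive; squaring nonnegative
  numbers keeps this.\<close>

lemma sum_excess_square_le_excess_sum_square:
  fixes r :: "'a \<Rightarrow> real" and \<gamma> :: real
  assumes "finite A" "\<And>j. j \<in> A \<Longrightarrow> 0 \<le> r j" "0 \<le> \<gamma>"
  shows "(\<Sum>j\<in>A. (max (r j - \<gamma>) 0)\<^sup>2) \<le> (max (sum r A - \<gamma>) 0)\<^sup>2"
  using assms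
proof (induction A rule: finite_induct)
  case empty
  then show ?case by simp
next
  case (insert a A)
  let ?x = "max (r a - \<gamma>) 0" and ?y = "max (sum r A - \<gamma>) 0"
  have nn: "0 \<le> r a" "0 \<le> sum r A" using insert by (auto intro: sum_nonneg)
  have "?x\<^sup>2 + ?y\<^sup>2 \<le> (?x + ?y)\<^sup>2" by (simp add: power2_sum)
  also have "\<dots> \<le> (max (r a + sum r A - \<gamma>) 0)\<^sup>2"
    using nn insert.prems(2) by (intro power_mono) (simp_all add: max_def)
  finally show ?case using insert by simp
qed

section \<open>Measurability and integration on the real line\<close>

text \<open>Both sides default to 0 when the family is not summable, so the equation is
  unconditional. It makes measurability results for integrals available for infinite sums.\<close>

lemma infsum_eq_integral_count_space:
  fixes f :: "'a \<Rightarrow> real"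
  shows "infsum f A = (\<integral>x. f x \<partial>count_space A)"
proof (cases "f summable_on A")
  case True
  then have "Infinite_Sum.abs_summable_on f A"
    by (rule summable_on_iff_abs_summable_on_real[THEN iffD1])
  from infsetsum_infsum[OF this[unfolded abs_summable_equivalent]]
  show ?thesis by (simp only: infsetsum_def)
next
  case False
  then have "\<not> Infinite_Set_Sum.abs_summable_on f A"
    using summable_on_iff_abs_summable_on_real[THEN iffD2, OF abs_summable_equivalent[THEN iffD2]]
    by blast
  then have "infsetsum f A = 0"
    by (rule not_summable_infsetsum_eq)
  then show ?thesis
    using False by (simp add: infsum_not_exists infsetsum_def)
qed

lemma borel_measurable_infsum:
  fixes f :: "'k \<Rightarrow> 'a \<Rightarrow> real"
  assumes "countable A" and "\<And>k. k \<in> A \<Longrightarrow> f k \<in> borel_measurable M"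
  shows "(\<lambda>x. \<Sum>\<^sub>\<infinity>k\<in>A. f k x) \<in> borel_measurable M"
proof -
  interpret sigma_finite_measure "count_space A"
    using assms(1) by (rule sigma_finite_measure_count_space_countable)
  have "(\<lambda>z. f (snd z) (fst z)) \<in> borel_measurable (M \<Otimes>\<^sub>M count_space A)"
  proof (rule measurable_compose_countable'[where f = "\<lambda>k z. f k (fst z)" and I = A])
    show "(\<lambda>z. f k (fst z)) \<in> borel_measurable (M \<Otimes>\<^sub>M count_space A)" if "k \<in> A" for k
      using measurable_fst assms(2)[OF that] by (rule measurable_compose)
  qed (rule measurable_snd assms(1))+
  then have "(\<lambda>(x, k). f k x) \<in> borel_measurable (M \<Otimes>\<^sub>M count_space A)"
    by (simp only: case_prod_beta')
  then show ?thesis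
    unfolding infsum_eq_integral_count_space by (rule borel_measurable_lebesgue_integral)
qed

lemma integral_beta_law:
  fixes f :: "real \<Rightarrow> real"
  assumes "1 < \<rho>" and [measurable]: "f \<in> borel_measurable borel"
  shows "(\<integral>\<beta>. f \<beta> \<partial>beta_law \<rho>) = (\<integral>x. indicator {0..<ln \<rho>} x * f (exp x) \<partial>lborel) / ln \<rho>"
proof -
  have pos: "0 < ln \<rho>" using assms(1) by simp
  have "(\<integral>\<beta>. f \<beta> \<partial>beta_law \<rho>) = (\<integral>x. f (exp x) \<partial>uniform_measure lborel {0..<ln \<rho>})"
    unfolding beta_law_def by (rule integral_distr) auto
  also have "uniform_measure lborel {0..<ln \<rho>} =
      density lborel (\<lambda>x. ennreal (indicator {0..<ln \<rho>} x / ln \<rho>))"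
    unfolding uniform_measure_def using pos
    by (intro arg_cong[where f = "density lborel"] ext)
       (auto simp: divide_ennreal split: split_indicator simp flip: ennreal_1)
  also have "(\<integral>x. f (exp x) \<partial>\<dots>) = (\<integral>x. (indicator {0..<ln \<rho>} x / ln \<rho>) *\<^sub>R f (exp x) \<partial>lborel)"
    using pos by (intro integral_density) auto
  also have "\<dots> = (\<integral>x. indicator {0..<ln \<rho>} x * f (exp x) / ln \<rho> \<partial>lborel)"
    by (simp add: divide_simps)
  finally show ?thesis by simp
qed

text \<open>The substitution \<open>s = x / a - L + k\<close> carries \<open>[0, a)\<close> onto the
  tile \<open>[k - L, k + 1 - L)\<close> and scales lengths by \<open>1 / a\<close>. The tiles over
  all integers \<open>k\<close> partition the line, and \<open>g\<close> vanishes on those with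
  index outside \<open>K\<close>.\<close>

lemma integral_unfold_floor:
  fixes g :: "real \<Rightarrow> real" and a L :: real
  assumes "0 < a" "finite K" and g: "integrable lborel g"
    and supp: "\<And>s. g s \<noteq> 0 \<Longrightarrow> \<lfloor>s + L\<rfloor> \<in> K"
  shows "(\<integral>x. indicator {0..<a} x * (\<Sum>k\<in>K. g (x / a - L + of_int k)) \<partial>lborel)
           = a * (\<integral>s. g s \<partial>lborel)"
proof -
  let ?h = "\<lambda>k s. indicator {of_int k - L..<of_int k + 1 - L} s * g s"
  have int_h: "integrable lborel (?h k)" for k
    using integrable_mult_indicator[OF _ g] by simp
  have shift: "indicator {0..<a} x * g (x / a - L + of_int k) = ?h k ((of_int k - L) + (1 / a) * x)" for k x
    using assms(1) by (auto simp: indicator_def field_simps)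
  have int_shift: "integrable lborel (\<lambda>x. ?h k ((of_int k - L) + (1 / a) * x))" for k
    by (rule lborel_integrable_real_affine[OF int_h]) (use assms(1) in simp)
  have "(\<integral>x. indicator {0..<a} x * (\<Sum>k\<in>K. g (x / a - L + of_int k)) \<partial>lborel)
      = (\<integral>x. (\<Sum>k\<in>K. ?h k ((of_int k - L) + (1 / a) * x)) \<partial>lborel)"
    by (simp add: sum_distrib_left shift)
  also have "\<dots> = (\<Sum>k\<in>K. \<integral>x. ?h k ((of_int k - L) + (1 / a) * x) \<partial>lborel)"
    by (rule Bochner_Integration.integral_sum) (rule int_shift)
  also have "\<dots> = (\<Sum>k\<in>K. a * (\<integral>s. ?h k s \<partial>lborel))"
  proof (rule sum.cong[OF refl])
    fix k
    show "(\<integral>x. ?h k ((of_int k - L) + (1 / a) * x) \<partial>lborel) = a * (\<integral>s. ?h k s \<partial>lborel)"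
      using lborel_integral_real_affine[of "1 / a" "?h k" "of_int k - L"] assms(1)
      by (simp add: field_simps)
  qed
  also have "\<dots> = a * (\<integral>s. (\<Sum>k\<in>K. ?h k s) \<partial>lborel)"
    using int_h by (simp add: sum_distrib_left)
  also have "(\<integral>s. (\<Sum>k\<in>K. ?h k s) \<partial>lborel) = (\<integral>s. g s \<partial>lborel)"
  proof (rule Bochner_Integration.integral_cong[OF refl])
    fix s
    have "s \<in> {of_int k - L..<of_int k + 1 - L} \<longleftrightarrow> \<lfloor>s + L\<rfloor> = k" for k
      by (simp add: floor_eq_iff) linarith
    \<comment> \<open>Each point lies in exactly one tile, so the sum has at most one nonzero
      term.\<close>
    then have "?h k s = (if k = \<lfloor>s + L\<rfloor> then g s else 0)" for k
      by (auto simp: indicator_def)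
    then show "(\<Sum>k\<in>K. ?h k s) = g s"
      using supp[of s] assms(2) by auto
  qed
  finally show ?thesis .
qed

text \<open>A Borel representative of \<open>\<psi>\<close> may break the cap on a null set;
  clamping it between 0 and the cap restores the bounds everywhere and changes nothing where it
  agrees with \<open>\<psi>\<close>.\<close>

lemma ex_borel_profile:
  assumes "scale_profile \<rho> \<psi>"
  obtains \<phi> where "\<phi> \<in> borel_measurable borel" "AE s in lborel. \<psi> s = \<phi> s"
    "\<And>s. 0 \<le> \<phi> s \<and> \<phi> s \<le> bcap (\<rho> powr s)"
proof -
  from assms have m: "\<psi> \<in> borel_measurable lebesgue"
    and bd: "\<And>s. 0 \<le> \<psi> s \<and> \<psi> s \<le> bcap (\<rho> powr s)"
    by (auto simp: scale_profile_def)
  obtain g where g [measurable]: "g \<in> borel_measurable borel" and ae: "AE s in lborel. \<psi> s = g s"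
    using completion_ex_borel_measurable_real[OF m] by auto
  have [measurable]: "bcap \<in> borel_measurable borel" unfolding bcap_def by measurable
  have bnn: "0 \<le> bcap (\<rho> powr s)" for s using bd[of s] by linarith
  show thesis
  proof
    show "(\<lambda>s. max 0 (min (g s) (bcap (\<rho> powr s)))) \<in> borel_measurable borel" by measurable
    show "AE s in lborel. \<psi> s = max 0 (min (g s) (bcap (\<rho> powr s)))"
      using ae
    proof eventually_elim
      case (elim s)
      then show ?case using bd[of s] by (auto simp: max_def min_def)
    qed
  qed (use bnn in auto)
qed

lemma integral_lebesgue_eq_lborel_AE:
  fixes f g :: "real \<Rightarrow> real"
  assumes "f \<in> borel_measurable lebesgue" "g \<in> borel_measurable borel" "AE x in lborel. f x = g x"
  shows "(\<integral>x. f x \<partial>lebesgue) = (\<integral>x. g x \<partial>lborel)"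
proof -
  have "(\<integral>x. f x \<partial>lebesgue) = (\<integral>x. g x \<partial>lebesgue)"
    using assms by (intro integral_cong_AE AE_completion) (auto intro: measurable_completion)
  then show ?thesis using assms by (simp add: integral_completion)
qed


section \<open>Averages over the configurations of one machine\<close>

lemma sum_configs_swap:
  assumes "finite J" "finite P"
  shows "(\<Sum>f\<in>configs J w i. y i f * (\<Sum>j\<in>f \<inter> P. a j)) = (\<Sum>j\<in>P. zfrac J w y i j * a j)"
proof -
  have fin: "finite (configs J w i)"
    using assms by (simp add: configs_def feasible_jobs_def)
  have z: "zfrac J w y i j = (\<Sum>f\<in>configs J w i. if j \<in> f then y i f else 0)" for j
  proof -
    \<comment> \<open>An infeasible job lies in no configuration, so the zero branch of
      \<open>zfrac\<close> agrees with the empty sum and one formula covers all jobs.\<close>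
    have none: "{f \<in> configs J w i. j \<in> f} = {}" if "j \<notin> feasible_jobs J w i"
      using that by (auto simp: configs_def)
    have "zfrac J w y i j = (\<Sum>f\<in>{f \<in> configs J w i. j \<in> f}. y i f)"
    proof (cases "j \<in> feasible_jobs J w i")
      case False
      then show ?thesis unfolding zfrac_def none[OF False] by simp
    qed (simp add: zfrac_def)
    then show ?thesis
      using fin by (simp add: sum.inter_filter)
  qed
  have "(\<Sum>f\<in>configs J w i. y i f * (\<Sum>j\<in>f \<inter> P. a j))
      = (\<Sum>f\<in>configs J w i. \<Sum>j\<in>P. (if j \<in> f then y i f else 0) * a j)"
  proof (rule sum.cong[OF refl])
    fix f
    have "(\<Sum>j\<in>f \<inter> P. a j) = (\<Sum>j\<in>P. if j \<in> f then a j else 0)"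
      using assms(2) by (simp add: Int_commute[of f] sum.inter_restrict)
    then show "y i f * (\<Sum>j\<in>f \<inter> P. a j) = (\<Sum>j\<in>P. (if j \<in> f then y i f else 0) * a j)"
      by (auto simp: sum_distrib_left intro!: sum.cong)
  qed
  also have "\<dots> = (\<Sum>j\<in>P. zfrac J w y i j * a j)"
    by (subst sum.swap) (simp add: z sum_distrib_right)
  finally show ?thesis .
qed

lemma sum_zfrac_rsize:
  assumes "Vol J p w y i P \<noteq> 0"
  shows "(\<Sum>j\<in>P. zfrac J w y i j * rsize J p w y i P j) = 1"
proof -
  have "(\<Sum>j\<in>P. zfrac J w y i j * rsize J p w y i P j) = Vol J p w y i P / Vol J p w y i P"
    unfolding rsize_def times_divide_eq_right sum_divide_distrib[symmetric] by (simp add: Vol_def)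
  then show ?thesis using assms by simp
qed

lemma zfrac_nonneg:
  assumes "config_lp_feasible J M w y" "i \<in> M"
  shows "0 \<le> zfrac J w y i j"
  using assms by (auto simp: zfrac_def config_lp_feasible_def intro!: sum_nonneg)

text \<open>The weights \<open>y i\<close> form a probability distribution on configurations with
  mean load 1. For each configuration,
  \<open>T^2 = 2 \<gamma> T - \<gamma>^2 + (T - \<gamma>)^2\<close>, and the last square dominates
  the sum of the squared excesses of its jobs; averaging gives the bound.\<close>

lemma Fnorm_lower_bound:
  assumes "scheduling_instance J M p w" "config_lp_feasible J M w y" "i \<in> M"
    and "P \<subseteq> J" "0 < Vol J p w y i P" "0 \<le> \<gamma>"
  shows "2 * \<gamma> - \<gamma>\<^sup>2 + (\<Sum>j\<in>P. zfrac J w y i j * (max (rsize J p w y i P j - \<gamma>) 0)\<^sup>2)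
           \<le> Fnorm J p w y i P"
proof -
  let ?C = "configs J w i" and ?r = "rsize J p w y i P" and ?T = "Tload J p w y i P"
  have J: "finite J" "finite P" and p: "\<And>j. j \<in> P \<Longrightarrow> 0 < p j"
    using assms finite_subset by (auto simp: scheduling_instance_def)
  have y: "\<And>f. f \<in> ?C \<Longrightarrow> 0 \<le> y i f" "(\<Sum>f\<in>?C. y i f) = 1"
    using assms by (auto simp: config_lp_feasible_def)
  have r: "0 < ?r j" if "j \<in> P" for j
    using p[OF that] assms(5) by (simp add: rsize_def)
  have T: "(\<Sum>f\<in>?C. y i f * ?T f) = 1"
    using sum_configs_swap[OF J, where w = w and i = i and y = y and a = ?r] sum_zfrac_rsize[of J p w y i P] assms(5)
    by (simp add: Tload_def)
  \<comment> \<open>The constants become averages: \<open>2 \<gamma>\<close> is multiplied by the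
    mean load 1 and \<open>\<gamma>^2\<close> by the total weight 1.\<close>
  have "2 * \<gamma> - \<gamma>\<^sup>2 + (\<Sum>j\<in>P. zfrac J w y i j * (max (?r j - \<gamma>) 0)\<^sup>2)
      = 2 * \<gamma> * (\<Sum>f\<in>?C. y i f * ?T f) - \<gamma>\<^sup>2 * (\<Sum>f\<in>?C. y i f)
        + (\<Sum>f\<in>?C. y i f * (\<Sum>j\<in>f \<inter> P. (max (?r j - \<gamma>) 0)\<^sup>2))"
    unfolding T y(2) sum_configs_swap[OF J] by simp
  also have "\<dots> = (\<Sum>f\<in>?C. y i f *
      (2 * \<gamma> * ?T f - \<gamma>\<^sup>2 + (\<Sum>j\<in>f \<inter> P. (max (?r j - \<gamma>) 0)\<^sup>2)))"
    by (simp add: sum_distrib_left sum.distrib sum_subtractf algebra_simps)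
  also have "\<dots> \<le> Fnorm J p w y i P"
    unfolding Fnorm_def
  proof (intro sum_mono mult_left_mono y)
    fix f
    have "(\<Sum>j\<in>f \<inter> P. (max (?r j - \<gamma>) 0)\<^sup>2) \<le> (max (?T f - \<gamma>) 0)\<^sup>2"
      unfolding Tload_def using J r assms(6)
      by (intro sum_excess_square_le_excess_sum_square) (auto intro: less_imp_le)
    also have "\<dots> \<le> (?T f - \<gamma>)\<^sup>2" by (simp add: max_def)
    also have "\<dots> = (?T f)\<^sup>2 - (2 * \<gamma> * ?T f - \<gamma>\<^sup>2)" by (simp add: power2_diff)
    finally show "2 * \<gamma> * ?T f - \<gamma>\<^sup>2 + (\<Sum>j\<in>f \<inter> P. (max (?r j - \<gamma>) 0)\<^sup>2) \<le> (?T f)\<^sup>2"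
      by simp
  qed
  finally show ?thesis .
qed

section \<open>The class saving in logarithmic coordinates\<close>

text \<open>This is \<open>v(s)\<close> of the overview: with \<open>l\<close> the logarithm of the
  size to base \<open>\<rho>\<close>, a size class of ratio \<open>\<rho>\<close> becomes a window
  of length 1.\<close>

definition window_mass :: "'a set \<Rightarrow> ('a \<Rightarrow> real) \<Rightarrow> ('a \<Rightarrow> real) \<Rightarrow> real \<Rightarrow> real" where
  "window_mass P m l s = (\<Sum>j\<in>{j\<in>P. s \<le> l j \<and> l j < s + 1}. m j)"

text \<open>Reversing the viewpoint, from the jobs seen at \<open>s\<close> to the points
  \<open>s\<close> that see a job, produces the windows over which \<open>unit_window\<close>
  integrates.\<close>

lemma window_mass_eq_indicator:
  assumes "finite P"
  shows "window_mass P m l s = (\<Sum>j\<in>P. m j * indicator {l j - 1<..l j} s)"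
  unfolding window_mass_def sum.inter_filter[OF assms]
  by (intro sum.cong refl) (auto simp: indicator_def)

lemma borel_measurable_window_mass [measurable]:
  assumes "finite P"
  shows "window_mass P m l \<in> borel_measurable borel"
  unfolding window_mass_eq_indicator[OF assms, abs_def] by measurable

lemma window_mass_bounds:
  assumes "finite P" "\<And>j. j \<in> P \<Longrightarrow> 0 \<le> m j"
  shows "0 \<le> window_mass P m l s" "window_mass P m l s \<le> sum m P"
  using assms by (auto simp: window_mass_def intro!: sum_nonneg sum_mono2)

text \<open>Dividing sizes by the volume and taking logarithms to base \<open>\<rho>\<close> turns
  \<open>exp x * \<rho>^k\<close> into \<open>s\<close>, and the factor \<open>\<rho>\<close> to the
  next threshold into a shift by 1.\<close>

lemma class_eq_window_mass:
  fixes x :: real and k :: int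
  defines "s \<equiv> \<lambda>V \<rho>. x / ln \<rho> - log \<rho> V + of_int k"
  assumes "1 < \<rho>" "0 < Vol J p w y i P" "\<And>j. j \<in> P \<Longrightarrow> 0 < p j"
  shows "tau_class J p w y i P \<rho> (exp x) k = \<rho> powr s (Vol J p w y i P) \<rho>"
    and "v_class J p w y i P \<rho> (exp x) k =
           window_mass P (\<lambda>j. zfrac J w y i j * rsize J p w y i P j)
             (\<lambda>j. log \<rho> (rsize J p w y i P j)) (s (Vol J p w y i P) \<rho>)"
proof -
  let ?V = "Vol J p w y i P"
  let ?s = "s ?V \<rho>"
  have l: "0 < ln \<rho>" using assms by simp
  have "?s * ln \<rho> = x + of_int k * ln \<rho> - ln ?V"
    using l by (simp add: s_def log_def field_simps)
  then have "\<rho> powr ?s = exp x * exp (of_int k * ln \<rho>) / ?V"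
    using assms by (simp add: powr_def exp_add exp_diff)
  also have "exp (of_int k * ln \<rho>) = \<rho> powi k"
    using assms powr_real_of_int'[of \<rho> k] by (simp add: powr_def)
  finally have tau: "\<rho> powr ?s = exp x * \<rho> powi k / ?V" .
  then show "tau_class J p w y i P \<rho> (exp x) k = \<rho> powr ?s"
    by (simp add: tau_class_def)
  have "(exp x * \<rho> powi k \<le> p j \<and> p j < exp x * \<rho> powi (k + 1)) \<longleftrightarrow>
      (?s \<le> log \<rho> (rsize J p w y i P j) \<and> log \<rho> (rsize J p w y i P j) < ?s + 1)"
    if "j \<in> P" for j
  proof -
    have r: "0 < rsize J p w y i P j" using that assms by (simp add: rsize_def)
    have "exp x * \<rho> powi k \<le> p j \<longleftrightarrow> \<rho> powr ?s \<le> rsize J p w y i P j"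
      using assms unfolding tau by (simp add: rsize_def divide_le_cancel)
    moreover have "p j < exp x * \<rho> powi (k + 1) \<longleftrightarrow> rsize J p w y i P j < \<rho> powr (?s + 1)"
      using assms unfolding powr_add tau by (simp add: rsize_def power_int_add divide_less_cancel mult.assoc)
    ultimately show ?thesis
      using assms r by (simp add: le_log_iff log_less_iff)
  qed
  then show "v_class J p w y i P \<rho> (exp x) k =
      window_mass P (\<lambda>j. zfrac J w y i j * rsize J p w y i P j)
        (\<lambda>j. log \<rho> (rsize J p w y i P j)) ?s"
    unfolding v_class_def window_mass_def by (intro sum.cong) auto
qed

lemma borel_measurable_class_saving:
  assumes "finite P"
  shows "class_saving J p w y i P \<rho> \<in> borel_measurable borel"
proof -
  have [measurable]: "(\<lambda>\<beta>. v_class J p w y i P \<rho> \<beta> k) \<in> borel_measurable borel" for k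
    unfolding v_class_def using assms by (simp add: sum.inter_filter)
  have [measurable]: "(\<lambda>\<beta>. tau_class J p w y i P \<rho> \<beta> k) \<in> borel_measurable borel" for k
    unfolding tau_class_def by measurable
  show ?thesis
    unfolding class_saving_def[abs_def] by (intro borel_measurable_infsum) auto
qed

text \<open>As \<open>\<beta>\<close> runs over \<open>[1, \<rho>)\<close> and \<open>k\<close> over the integers, \<open>log \<rho> (\<tau>\<^sub>k)\<close> sweeps the real line once.\<close>

lemma mean_class_saving_eq:
  fixes J p w y i P and \<rho> :: real
  defines "l \<equiv> \<lambda>j. log \<rho> (rsize J p w y i P j)"
  defines "v \<equiv> window_mass P (\<lambda>j. zfrac J w y i j * rsize J p w y i P j) l"
  assumes "1 < \<rho>" "finite P" "0 < Vol J p w y i P" "\<And>j. j \<in> P \<Longrightarrow> 0 < p j"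
    and z: "\<And>j. 0 \<le> zfrac J w y i j"
  shows "mean_class_saving J p w y i P \<rho> = (\<integral>s. (min (v s) (\<rho> powr s))\<^sup>2 \<partial>lborel)"
    and "integrable lborel (\<lambda>s. (min (v s) (\<rho> powr s))\<^sup>2)"
proof -
  let ?g = "\<lambda>s. (min (v s) (\<rho> powr s))\<^sup>2"
  define L where "L = log \<rho> (Vol J p w y i P)"
  define m where "m j = zfrac J w y i j * rsize J p w y i P j" for j
  have v: "v = window_mass P m l" by (simp add: v_def m_def[abs_def])
  \<comment> \<open>The shift by \<open>L\<close> cancels the volume, so \<open>s + L\<close> is
    \<open>x / ln \<rho> + k\<close>, whose floor is \<open>k\<close> for \<open>x\<close> in
    \<open>[0, ln \<rho>)\<close>. Hence \<open>K\<close> contains every class index that can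
    contribute, uniformly in \<open>x\<close>.\<close>
  define K where "K = (\<Union>j\<in>P. {\<lfloor>l j - 1 + L\<rfloor>..\<lfloor>l j + L\<rfloor>})"
  have finK: "finite K" using assms by (simp add: K_def)
  have m: "0 \<le> m j" if "j \<in> P" for j
    using that assms by (simp add: m_def rsize_def less_imp_le)
  have vb: "0 \<le> v s" "v s \<le> sum m P" for s
    using window_mass_bounds[of P m l s] \<open>finite P\<close> m by (auto simp: v)
  have supp_j: "\<exists>j\<in>P. l j - 1 < s \<and> s \<le> l j" if "?g s \<noteq> 0" for s
  proof (rule ccontr)
    assume "\<not> ?thesis"
    then have none: "{j\<in>P. s \<le> l j \<and> l j < s + 1} = {}" by force
    \<comment> \<open>An empty window makes the minimum 0, because the other argument
      \<open>\<rho> powr s\<close> is nonnegative.\<close>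
    have "v s = 0" unfolding v window_mass_def none by simp
    with that show False by simp
  qed
  have supp: "\<lfloor>s + L\<rfloor> \<in> K" if nz: "?g s \<noteq> 0" for s
  proof -
    obtain j where "j \<in> P" "l j - 1 < s" "s \<le> l j" using supp_j[OF nz] by blast
    then have "\<lfloor>s + L\<rfloor> \<in> {\<lfloor>l j - 1 + L\<rfloor>..\<lfloor>l j + L\<rfloor>}" by (auto intro!: floor_mono)
    with \<open>j \<in> P\<close> show ?thesis unfolding K_def by blast
  qed
  have [measurable]: "v \<in> borel_measurable borel" unfolding v using assms by simp
  show int: "integrable lborel ?g"
  proof (rule Bochner_Integration.integrable_bound)
    \<comment> \<open>The integrand is at most the squared total mass and lives on finitely many
      unit windows, which gives this dominating step function.\<close>
    show "integrable lborel (\<lambda>s. \<Sum>j\<in>P. (sum m P)\<^sup>2 * indicator {l j - 1<..l j} s)"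
      by (intro Bochner_Integration.integrable_sum integrable_mult_right) simp
    show "AE s in lborel. norm (?g s) \<le> norm (\<Sum>j\<in>P. (sum m P)\<^sup>2 * indicator {l j - 1<..l j} s)"
    proof (rule AE_I2)
      fix s
      show "norm (?g s) \<le> norm (\<Sum>j\<in>P. (sum m P)\<^sup>2 * indicator {l j - 1<..l j} s)"
      proof (cases "?g s = 0")
        case False
        then obtain j where j: "j \<in> P" "l j - 1 < s" "s \<le> l j" using supp_j by blast
        have "?g s \<le> (sum m P)\<^sup>2" using vb[of s] by (intro power_mono) auto
        also have "\<dots> = (sum m P)\<^sup>2 * indicator {l j - 1<..l j} s" using j by simp
        also have "\<dots> \<le> (\<Sum>j\<in>P. (sum m P)\<^sup>2 * indicator {l j - 1<..l j} s)"
          using j assms by (intro member_le_sum) auto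
        finally show ?thesis by simp
      qed simp
    qed
  qed simp
  have saving: "class_saving J p w y i P \<rho> (exp x) = (\<Sum>k\<in>K. ?g (x / ln \<rho> - L + of_int k))"
    if "x \<in> {0..<ln \<rho>}" for x
  proof -
    have t: "(min (v_class J p w y i P \<rho> (exp x) k) (tau_class J p w y i P \<rho> (exp x) k))\<^sup>2
        = ?g (x / ln \<rho> - L + of_int k)" for k
      using class_eq_window_mass[of \<rho> J p w y i P x k] assms(3-6)
      by (simp add: L_def v_def l_def)
    \<comment> \<open>Classes with index outside \<open>K\<close> save nothing, so the infinite sum
      collapses to a finite one that can be integrated term by term.\<close>
    have "?g (x / ln \<rho> - L + of_int k) = 0" if "k \<notin> K" for k
    proof (rule ccontr)
      assume "?g (x / ln \<rho> - L + of_int k) \<noteq> 0"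
      from supp[OF this] have "\<lfloor>x / ln \<rho> + of_int k\<rfloor> \<in> K" by simp
      moreover have "\<lfloor>x / ln \<rho> + of_int k\<rfloor> = k"
        using \<open>x \<in> {0..<ln \<rho>}\<close> assms(3) by (simp add: floor_eq_iff)
      ultimately show False using \<open>k \<notin> K\<close> by simp
    qed
    then have "class_saving J p w y i P \<rho> (exp x)
        = (\<Sum>\<^sub>\<infinity>k\<in>K. ?g (x / ln \<rho> - L + of_int k))"
      unfolding class_saving_def t by (intro infsum_cong_neutral) auto
    then show ?thesis using finK by simp
  qed
  have "mean_class_saving J p w y i P \<rho>
      = (\<integral>x. indicator {0..<ln \<rho>} x * class_saving J p w y i P \<rho> (exp x) \<partial>lborel) / ln \<rho>"
    unfolding mean_class_saving_def
    by (intro integral_beta_law borel_measurable_class_saving assms)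
  also have "(\<integral>x. indicator {0..<ln \<rho>} x * class_saving J p w y i P \<rho> (exp x) \<partial>lborel)
      = (\<integral>x. indicator {0..<ln \<rho>} x * (\<Sum>k\<in>K. ?g (x / ln \<rho> - L + of_int k)) \<partial>lborel)"
    by (intro Bochner_Integration.integral_cong refl) (simp add: saving indicator_def)
  also have "\<dots> = ln \<rho> * (\<integral>s. ?g s \<partial>lborel)"
    using assms(3) by (intro integral_unfold_floor finK int supp) auto
  finally show "mean_class_saving J p w y i P \<rho> = (\<integral>s. ?g s \<partial>lborel)"
    using assms(3) by simp
qed

section \<open>From the profile to the saving, and the final averaging\<close>

text \<open>The truncation inequality is applied at every \<open>s\<close> with \<open>b\<close> a
  Borel version of \<open>\<psi>\<close> and \<open>v\<close> the window mass. On integration the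
  cross term splits job by job into window integrals, and the square term becomes the cost.\<close>

lemma mean_class_saving_lower_bound:
  assumes "1 < \<rho>" "scheduling_instance J M p w" "config_lp_feasible J M w y" "i \<in> M"
    and "P \<subseteq> J" "0 < Vol J p w y i P" "scale_profile \<rho> \<psi>"
  shows "(\<Sum>j\<in>P. zfrac J w y i j * rsize J p w y i P j * unit_window \<rho> \<psi> (rsize J p w y i P j))
           - profile_cost \<psi> \<le> mean_class_saving J p w y i P \<rho>"
proof -
  define l where "l j = log \<rho> (rsize J p w y i P j)" for j
  define m where "m j = zfrac J w y i j * rsize J p w y i P j" for j
  define v where "v = window_mass P m l"
  have fin: "finite P" and p: "\<And>j. j \<in> P \<Longrightarrow> 0 < p j"
    using assms finite_subset by (auto simp: scheduling_instance_def)
  note z = zfrac_nonneg[OF assms(3,4)]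
  have m: "0 \<le> m j" if "j \<in> P" for j
    using that z p assms(6) by (simp add: m_def rsize_def less_imp_le)
  have "sum m P = 1"
    using sum_zfrac_rsize[of J p w y i P] assms(6) by (simp add: m_def)
  then have v: "0 \<le> v s" "v s \<le> 1" for s
    using window_mass_bounds[of P m l s] fin m by (auto simp: v_def)
  obtain \<phi> where [measurable]: "\<phi> \<in> borel_measurable borel" and ae: "AE s in lborel. \<psi> s = \<phi> s"
    and \<phi>: "\<And>s. 0 \<le> \<phi> s \<and> \<phi> s \<le> bcap (\<rho> powr s)"
    using ex_borel_profile[OF assms(7)] by blast
  have \<psi>: "\<psi> \<in> borel_measurable lebesgue" "integrable lebesgue (\<lambda>s. (\<psi> s)\<^sup>2)"
    using assms(7) by (auto simp: scale_profile_def)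
  have cost: "profile_cost \<psi> = (\<integral>s. (\<phi> s)\<^sup>2 \<partial>lborel)"
    unfolding profile_cost_def using \<psi> ae by (intro integral_lebesgue_eq_lborel_AE) auto
  have "integrable lebesgue (\<lambda>s. (\<phi> s)\<^sup>2)"
    using \<psi>(2)
  proof (rule integrable_cong_AE_imp)
    show "AE s in lebesgue. (\<psi> s)\<^sup>2 = (\<phi> s)\<^sup>2" using AE_completion[OF ae] by auto
  qed (auto intro: measurable_completion)
  then have int_sq: "integrable lborel (\<lambda>s. (\<phi> s)\<^sup>2)"
    by (simp add: integrable_completion)
  \<comment> \<open>The cap bounds the profile by 1, which makes it integrable on each unit
    window.\<close>
  have bcap_le: "bcap \<tau> \<le> 1" if "0 < \<tau>" for \<tau>
    using that by (auto simp: bcap_def power_le_one)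
  have int_win: "integrable lborel (\<lambda>s. indicator {l j - 1<..l j} s * \<phi> s)" for j
  proof (rule Bochner_Integration.integrable_bound)
    show "integrable lborel (indicator {l j - 1<..l j} :: real \<Rightarrow> real)" by simp
    show "AE s in lborel. norm (indicator {l j - 1<..l j} s * \<phi> s)
        \<le> norm (indicator {l j - 1<..l j} s :: real)"
    proof (rule AE_I2)
      fix s
      have "\<phi> s \<le> 1" using \<phi>[of s] bcap_le[of "\<rho> powr s"] assms(1) by simp
      then show "norm (indicator {l j - 1<..l j} s * \<phi> s) \<le> norm (indicator {l j - 1<..l j} s :: real)"
        using \<phi>[of s] by (simp add: indicator_def)
    qed
  qed simp
  have window: "unit_window \<rho> \<psi> (rsize J p w y i P j)
      = 2 * (\<integral>s. indicator {l j - 1<..l j} s * \<phi> s \<partial>lborel)" for j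
  proof -
    \<comment> \<open>\<open>unit_window\<close> uses the closed interval, whereas the classes give
      one open on the left; they differ only in this null point.\<close>
    have "AE s in lborel. s \<noteq> l j - 1" by (rule AE_lborel_singleton)
    with ae have "AE s in lborel. indicator {l j - 1..l j} s *\<^sub>R \<psi> s = indicator {l j - 1<..l j} s * \<phi> s"
      by eventually_elim (auto simp: indicator_def)
    then show ?thesis
      unfolding unit_window_def set_lebesgue_integral_def l_def[symmetric] using \<psi>(1)
      by (subst integral_lebesgue_eq_lborel_AE[where g = "\<lambda>s. indicator {l j - 1<..l j} s * \<phi> s"])
         (auto intro!: borel_measurable_times borel_measurable_indicator)
  qed
  have twice: "2 * \<phi> s * v s = (\<Sum>j\<in>P. 2 * m j * (indicator {l j - 1<..l j} s * \<phi> s))" for s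
    unfolding v_def window_mass_eq_indicator[OF fin] by (simp add: sum_distrib_left algebra_simps)
  have int_twice: "integrable lborel (\<lambda>s. 2 * \<phi> s * v s)"
    unfolding twice using int_win by simp
  have "(\<integral>s. 2 * \<phi> s * v s \<partial>lborel)
      = (\<Sum>j\<in>P. \<integral>s. 2 * m j * (indicator {l j - 1<..l j} s * \<phi> s) \<partial>lborel)"
    unfolding twice by (intro Bochner_Integration.integral_sum integrable_mult_right int_win)
  also have "\<dots> = (\<Sum>j\<in>P. m j * unit_window \<rho> \<psi> (rsize J p w y i P j))"
    unfolding window integral_mult_right_zero by (simp add: mult_ac)
  finally have "(\<Sum>j\<in>P. m j * unit_window \<rho> \<psi> (rsize J p w y i P j)) - profile_cost \<psi>
      = (\<integral>s. 2 * \<phi> s * v s \<partial>lborel) - (\<integral>s. (\<phi> s)\<^sup>2 \<partial>lborel)"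
    using cost by simp
  also have "\<dots> = (\<integral>s. 2 * \<phi> s * v s - (\<phi> s)\<^sup>2 \<partial>lborel)"
    using int_twice int_sq by simp
  also have "\<dots> \<le> (\<integral>s. (min (v s) (\<rho> powr s))\<^sup>2 \<partial>lborel)"
    using mean_class_saving_eq(2)[OF assms(1) fin assms(6) p z] int_twice int_sq v \<phi> assms(1)
    by (intro integral_mono two_mult_diff_square_le_min_square)
       (auto simp: v_def m_def[abs_def] l_def[abs_def])
  also have "\<dots> = mean_class_saving J p w y i P \<rho>"
    using mean_class_saving_eq(1)[OF assms(1) fin assms(6) p z]
    by (simp add: v_def m_def[abs_def] l_def[abs_def])
  finally show ?thesis by (simp add: m_def)
qed

theorem theorem3p4:
  fixes J :: "'j set" and M :: "'m set"
    and p :: "'j \<Rightarrow> real" and w :: "'m \<Rightarrow> 'j \<Rightarrow> ereal"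
    and y :: "'m \<Rightarrow> 'j set \<Rightarrow> real"
    and i :: 'm and \<sigma> :: "nat \<Rightarrow> 'j" and js :: nat and P :: "'j set"
    and \<rho> \<gamma> \<alpha> :: real and \<psi> :: "real \<Rightarrow> real"
  assumes "1 < \<rho>" and "0 \<le> \<gamma>" and "1 < \<alpha>"
    and "scheduling_instance J M p w"
    and "config_lp_feasible J M w y"
    and "i \<in> M"
    and "smith_order J p w i \<sigma>"
    and "1 \<le> js" and "js \<le> card J"
    and "P = smith_prefix \<sigma> js"
    and "0 < Vol J p w y i P"
    and "scale_profile \<rho> \<psi>"
    and "\<exists>t::real.
           (\<forall>r>0. unit_window \<rho> \<psi> r + \<alpha> * hexcess \<gamma> r - (2 - \<alpha>) * r \<ge> t) \<and>
           t + \<alpha> * (2 * \<gamma> - \<gamma>\<^sup>2) - 1 - profile_cost \<psi> \<ge> 0"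
  shows "2 * Qnorm J p w y i P + 1 - mean_class_saving J p w y i P \<rho>
           \<le> \<alpha> * (Qnorm J p w y i P + Fnorm J p w y i P)"
proof -
  let ?z = "zfrac J w y i" and ?r = "rsize J p w y i P"
  from assms(13) obtain t where
    t: "\<And>r. 0 < r \<Longrightarrow> t \<le> unit_window \<rho> \<psi> r + \<alpha> * hexcess \<gamma> r - (2 - \<alpha>) * r"
    and t_cost: "0 \<le> t + \<alpha> * (2 * \<gamma> - \<gamma>\<^sup>2) - 1 - profile_cost \<psi>" by auto
  have PJ: "P \<subseteq> J"
    using assms(7,9,10) by (force simp: smith_prefix_def smith_order_def bij_betw_def)
  have r: "0 < ?r j" if "j \<in> P" for j
    using that PJ assms(4,11) by (auto simp: rsize_def scheduling_instance_def)
  have mass: "(\<Sum>j\<in>P. ?z j * ?r j) = 1"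
    using assms(11) by (intro sum_zfrac_rsize) simp
  define W where "W = (\<Sum>j\<in>P. ?z j * ?r j * unit_window \<rho> \<psi> (?r j))"
  define H where "H = (\<Sum>j\<in>P. ?z j * (max (?r j - \<gamma>) 0)\<^sup>2)"
  \<comment> \<open>The weights \<open>z_j r_j\<close> have total 1, so a pointwise lower bound
    survives averaging.\<close>
  have "t = (\<Sum>j\<in>P. ?z j * ?r j * t)" by (simp add: mass flip: sum_distrib_right)
  also have "\<dots> \<le> (\<Sum>j\<in>P. ?z j * ?r j *
      (unit_window \<rho> \<psi> (?r j) + \<alpha> * hexcess \<gamma> (?r j) - (2 - \<alpha>) * ?r j))"
    using zfrac_nonneg[OF assms(5,6)] r
    by (intro sum_mono mult_left_mono t mult_nonneg_nonneg) (auto intro: less_imp_le)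
  \<comment> \<open>The factor \<open>r_j\<close> in the weight cancels the denominator of
    \<open>hexcess\<close>, leaving the squared excess of the load bound, and turns the linear term
    into the summand of \<open>Qnorm\<close>.\<close>
  also have "\<dots> = (\<Sum>j\<in>P. ?z j * ?r j * unit_window \<rho> \<psi> (?r j)
      + \<alpha> * (?z j * (max (?r j - \<gamma>) 0)\<^sup>2) - (2 - \<alpha>) * (?z j * (?r j)\<^sup>2))"
  proof (rule sum.cong[OF refl])
    fix j assume "j \<in> P"
    then show "?z j * ?r j * (unit_window \<rho> \<psi> (?r j) + \<alpha> * hexcess \<gamma> (?r j) - (2 - \<alpha>) * ?r j)
        = ?z j * ?r j * unit_window \<rho> \<psi> (?r j)
          + \<alpha> * (?z j * (max (?r j - \<gamma>) 0)\<^sup>2) - (2 - \<alpha>) * (?z j * (?r j)\<^sup>2)"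
      using r[of j] by (simp add: hexcess_def power2_eq_square field_simps)
  qed
  also have "\<dots> = W + \<alpha> * H - (2 - \<alpha>) * Qnorm J p w y i P"
    by (simp add: W_def H_def Qnorm_def sum.distrib sum_subtractf sum_distrib_left)
  finally have main: "t \<le> W + \<alpha> * H - (2 - \<alpha>) * Qnorm J p w y i P" .
  have "W - profile_cost \<psi> \<le> mean_class_saving J p w y i P \<rho>"
    unfolding W_def by (rule mean_class_saving_lower_bound[OF assms(1,4,5,6) PJ assms(11,12)])
  moreover have "\<alpha> * (2 * \<gamma> - \<gamma>\<^sup>2 + H) \<le> \<alpha> * Fnorm J p w y i P"
    unfolding H_def
    using Fnorm_lower_bound[OF assms(4,5,6) PJ assms(11,2)] assms(3) by simp
  \<comment> \<open>Adding the two bounds, the saving plus \<open>\<alpha> F\<close> is at least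
    \<open>W + \<alpha> H + \<alpha> (2 \<gamma> - \<gamma>^2)\<close> minus the cost. By
    \<open>main\<close> and \<open>t_cost\<close> this is at least
    \<open>(2 - \<alpha>) Q + 1\<close>.\<close>
  ultimately show ?thesis
    using main t_cost by (simp add: algebra_simps)
qed

end
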